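(* Let $\mathbf{A}_1$ and $\mathbf{A}_2$ be sets of prime operators with $\mathbf{A}_1\simeq\mathbf{A}_2$. Then $\mathcal{L}(\mathbf{A}_1)\equiv\mathcal{L}(\mathbf{A}_2)$.
   Context: Write $\mathbb{B}=\{0,1\}$. Static formulas are built from propositional variables and $\top,\bot$ using $\neg,\land,\lor$. An operator automaton is $\mathcal{A}=\langle \mathbb{B}^m,[1,n],\delta,q_{\mathrm{init}}\rangle$ with $\delta:[1,n]\times\mathbb{B}^m\to[1,n]$, $q_{\mathrm{init}}\in[1,n]$. Rules: static $p \;{:}{-}\; \alpha$; delay $p \;{:}{-}\; \ominus q$; dynamic $p_1,\dots,p_n \;{:}{-}\; \mathcal{A}(a_1,\dots,a_m)$. A program is a finite set of rules that is nonrecursive (the graph with an edge $a\to b$ whenever $a$ occurs in the body and $b$ in the head of a rule is acyclic) and definitorial (each variable is in at most one head). Non-defined variables are input variables; an interpretation is a finite non-empty sequence $I=I_1,\dots,I_\ell$ of subsets of input variables. Satisfaction $(P,I,t)\models\cdot$: $\top$ holds, $\bot$ not; input $a$ holds iff $a\in I_t$; Boolean connectives as usual; $p$ defined by $p\;{:}{-}\;\alpha$ iff $(P,I,t)\models\alpha$; $p$ defined by $p\;{:}{-}\;\ominus q$ iff $(P,I,t-1)\models q$; for $p_i$ defined by a dynamic rule, $(P,I,0)\models p_i$ iff $q_{\mathrm{init}}=i$, and for $t>0$, $(P,I,t)\models p_i$ iff there are $j$ and $\sigma\in\mathbb{B}^m$ (an assignment to $a_1,\dots,a_m$, identified with the conjunction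 of literals it makes true) with $\delta(j,\sigma)=i$, $(P,I,t-1)\models p_j$, $(P,I,t)\models\sigma$. For a set $\mathbf{A}$ of operator automata, $\mathcal{L}(\mathbf{A})$ is the set of programs consisting of static rules, delay rules and dynamic rules with operators from $\mathbf{A}$. A program with ordered input variables and a designated variable $a$ recognises the language of strings $\sigma_1\dots\sigma_\ell$ over $\mathbb{B}^m$ (letters read as assignments to the input variables) with $(P,I,\ell)\models a$; the expressivity of a logic is the set of languages its programs recognise; $\mathcal{L}_1\sqsubseteq\mathcal{L}_2$ means the expressivity of $\mathcal{L}_1$ is contained in that of $\mathcal{L}_2$, and $\mathcal{L}_1\equiv\mathcal{L}_2$ means both $\sqsubseteq$ hold. Semiautomata $\langle\Sigma,Q,\delta\rangle$; composition with input function $\phi:\Sigma\to\Pi$ of $\langle\Pi,Q,\delta\rangle$ is $\langle\Sigma,Q,\delta_\phi\rangle$ with $\delta_\phi(q,\sigma)=\delta(q,\phi(\sigma))$. Isomorphism of $\langle\Sigma,Q,\delta\rangle$ and $\langle\Sigma',Q',\delta'\rangle$: bijections $\psi_1:\Sigma\to\Sigma'$, $\psi_2:Q\to Q'$ with $\psi_2(\delta(q,\sigma))=\delta'(\psi_2(q),\psi_1(\sigma))$. The flip-flop monoid is $\{s,r,e\}$ with identity $e$ and $x\cdot s=s$, $x\cdot r=r$ for $x\in\{s,r\}$; a semigroup $S$ defines the semiautomaton $\langle S\cup\{e\},S,(s_1,s_2)\mapsto s_1\cdot s_2\rangle$. A prime semiautomaton is one isomorphic to the semiautomaton defined by the flip-flop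 monoid (the paper also counts the canonical two-state flip-flop, with inputs set/reset/read, as such) or to the semiautomaton defined by a simple group (a group whose only normal subgroups are trivial or itself). A prime operator is an operator automaton whose semiautomaton is the composition of a surjective input function with a prime semiautomaton, called its core. Operators are similar, $\mathcal{A}_1\simeq\mathcal{A}_2$, if their cores are isomorphic; for sets, $\mathbf{A}_1\simeq\mathbf{A}_2$ means every operator of either set is similar to some operator of the other. *)

theory Defs
  imports "HOL-Algebra.Coset"
begin

section \<open>Semiautomata\<close>

text \<open>
  Alphabet and states are carrier sets; the transition function is only meaningful on
  \<^term>\<open>Q \<times> \<Sigma>\<close>, so identity of semiautomata is the relation \<open>sa_same\<close> rather than HOL equality.
\<close>

record ('s, 'q) semiautomaton =
  alphabet :: "'s set"
  states :: "'q set"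
  step :: "'q \<Rightarrow> 's \<Rightarrow> 'q"

definition wf_semiautomaton :: "('s, 'q) semiautomaton \<Rightarrow> bool" where
  "wf_semiautomaton D \<longleftrightarrow> (\<forall>q\<in>states D. \<forall>s\<in>alphabet D. step D q s \<in> states D)"

definition sa_same :: "('s, 'q) semiautomaton \<Rightarrow> ('s, 'q) semiautomaton \<Rightarrow> bool" where
  "sa_same D D' \<longleftrightarrow> alphabet D = alphabet D' \<and> states D = states D' \<and>
     (\<forall>q\<in>states D. \<forall>s\<in>alphabet D. step D q s = step D' q s)"

definition sa_comp :: "'s set \<Rightarrow> ('s \<Rightarrow> 'p) \<Rightarrow> ('p, 'q) semiautomaton \<Rightarrow> ('s, 'q) semiautomaton" where
  "sa_comp \<Sigma> \<phi> D = \<lparr>alphabet = \<Sigma>, states = states D, step = (\<lambda>q s. step D q (\<phi> s))\<rparr>"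

definition sa_iso :: "('s, 'q) semiautomaton \<Rightarrow> ('s2, 'q2) semiautomaton \<Rightarrow> bool" where
  "sa_iso D D' \<longleftrightarrow> (\<exists>\<psi>1 \<psi>2.
     bij_betw \<psi>1 (alphabet D) (alphabet D') \<and> bij_betw \<psi>2 (states D) (states D') \<and>
     (\<forall>q\<in>states D. \<forall>s\<in>alphabet D. \<psi>2 (step D q s) = step D' (\<psi>2 q) (\<psi>1 s)))"

text \<open>The semiautomaton defined by a monoid; the monoid's identity plays the role of \<open>e\<close>.\<close>

definition sa_of_monoid :: "('a, 'b) monoid_scheme \<Rightarrow> ('a, 'a) semiautomaton" where
  "sa_of_monoid M =
     \<lparr>alphabet = carrier M \<union> {\<one>\<^bsub>M\<^esub>}, states = carrier M, step = (\<lambda>x y. x \<otimes>\<^bsub>M\<^esub> y)\<rparr>"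

datatype flipflop = FSet | FReset | FId

definition flipflop_monoid :: "flipflop monoid" where
  "flipflop_monoid =
     \<lparr>carrier = UNIV, monoid.mult = (\<lambda>x y. if y = FId then x else y), one = FId\<rparr>"

text \<open>The canonical two-state flip-flop: inputs set, reset and read, states \<open>True\<close> and \<open>False\<close>.\<close>

fun flipflop_step :: "bool \<Rightarrow> flipflop \<Rightarrow> bool" where
  "flipflop_step q FSet = True"
| "flipflop_step q FReset = False"
| "flipflop_step q FId = q"

definition two_state_flipflop :: "(flipflop, bool) semiautomaton" where
  "two_state_flipflop = \<lparr>alphabet = UNIV, states = UNIV, step = flipflop_step\<rparr>"

text \<open>Unlike the library's \<open>simple_group\<close>, the trivial group is included.\<close>

definition is_simple_group :: "('a, 'b) monoid_scheme \<Rightarrow> bool" where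
  "is_simple_group G \<longleftrightarrow> group G \<and> (\<forall>H. H \<lhd> G \<longrightarrow> H = {\<one>\<^bsub>G\<^esub>} \<or> H = carrier G)"

text \<open>
  Only prime semiautomata that are cores of operators matter. Those have states \<open>{1..n}\<close> and a
  finite alphabet, so up to renaming letters (and group elements) everything lives in \<^typ>\<open>nat\<close>.
\<close>

definition prime_semiautomaton :: "(nat, nat) semiautomaton \<Rightarrow> bool" where
  "prime_semiautomaton D \<longleftrightarrow> wf_semiautomaton D \<and>
     (sa_iso D (sa_of_monoid flipflop_monoid) \<or>
      sa_iso D two_state_flipflop \<or>
      (\<exists>G :: nat monoid. is_simple_group G \<and> sa_iso D (sa_of_monoid G)))"


section \<open>Operator automata\<close>

definition letters :: "nat \<Rightarrow> bool list set" where
  "letters m = {\<sigma>. length \<sigma> = m}"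

record op_automaton =
  arity :: nat
  nstates :: nat
  delta :: "nat \<Rightarrow> bool list \<Rightarrow> nat"
  q_init :: nat

definition wf_operator :: "op_automaton \<Rightarrow> bool" where
  "wf_operator A \<longleftrightarrow> q_init A \<in> {1..nstates A} \<and>
     (\<forall>j\<in>{1..nstates A}. \<forall>\<sigma>\<in>letters (arity A). delta A j \<sigma> \<in> {1..nstates A})"

definition op_semiautomaton :: "op_automaton \<Rightarrow> (bool list, nat) semiautomaton" where
  "op_semiautomaton A =
     \<lparr>alphabet = letters (arity A), states = {1..nstates A}, step = delta A\<rparr>"

definition is_core :: "(nat, nat) semiautomaton \<Rightarrow> op_automaton \<Rightarrow> bool" where
  "is_core D A \<longleftrightarrow> prime_semiautomaton D \<and>
     (\<exists>\<phi>. \<phi> ` letters (arity A) = alphabet D \<and>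
          sa_same (op_semiautomaton A) (sa_comp (letters (arity A)) \<phi> D))"

definition prime_operator :: "op_automaton \<Rightarrow> bool" where
  "prime_operator A \<longleftrightarrow> wf_operator A \<and> (\<exists>D. is_core D A)"

text \<open>
  Distinct letters of a prime semiautomaton act differently on its states, so the core of an
  operator is unique up to isomorphism and the choice of cores below is immaterial.
\<close>

definition similar :: "op_automaton \<Rightarrow> op_automaton \<Rightarrow> bool" where
  "similar A B \<longleftrightarrow> (\<exists>D E. is_core D A \<and> is_core E B \<and> sa_iso D E)"

definition similar_sets :: "op_automaton set \<Rightarrow> op_automaton set \<Rightarrow> bool" where
  "similar_sets \<A> \<B> \<longleftrightarrow>
     (\<forall>A\<in>\<A>. \<exists>B\<in>\<B>. similar A B) \<and> (\<forall>B\<in>\<B>. \<exists>A\<in>\<A>. similar B A)"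


section \<open>Programs\<close>

type_synonym var = nat

datatype form = Var var | Top | Bot | Neg form | And form form | Or form form

primrec fvars :: "form \<Rightarrow> var set" where
  "fvars (Var a) = {a}"
| "fvars Top = {}"
| "fvars Bot = {}"
| "fvars (Neg \<alpha>) = fvars \<alpha>"
| "fvars (And \<alpha> \<beta>) = fvars \<alpha> \<union> fvars \<beta>"
| "fvars (Or \<alpha> \<beta>) = fvars \<alpha> \<union> fvars \<beta>"

primrec eval_form :: "(var \<Rightarrow> bool) \<Rightarrow> form \<Rightarrow> bool" where
  "eval_form v (Var a) = v a"
| "eval_form v Top = True"
| "eval_form v Bot = False"
| "eval_form v (Neg \<alpha>) = (\<not> eval_form v \<alpha>)"
| "eval_form v (And \<alpha> \<beta>) = (eval_form v \<alpha> \<and> eval_form v \<beta>)"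
| "eval_form v (Or \<alpha> \<beta>) = (eval_form v \<alpha> \<or> eval_form v \<beta>)"

datatype rule =
    Static var form
  | Delay var var
  | Dynamic "var list" op_automaton "var list"

primrec heads :: "rule \<Rightarrow> var set" where
  "heads (Static p \<alpha>) = {p}"
| "heads (Delay p q) = {p}"
| "heads (Dynamic ps A as) = set ps"

primrec body_vars :: "rule \<Rightarrow> var set" where
  "body_vars (Static p \<alpha>) = fvars \<alpha>"
| "body_vars (Delay p q) = {q}"
| "body_vars (Dynamic ps A as) = set as"

primrec wf_rule :: "rule \<Rightarrow> bool" where
  "wf_rule (Static p \<alpha>) = True"
| "wf_rule (Delay p q) = True"
| "wf_rule (Dynamic ps A as) =
     (wf_operator A \<and> length ps = nstates A \<and> distinct ps \<and> length as = arity A)"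

definition dependency :: "rule set \<Rightarrow> (var \<times> var) set" where
  "dependency P = (\<Union>r\<in>P. body_vars r \<times> heads r)"

definition definitorial :: "rule set \<Rightarrow> bool" where
  "definitorial P \<longleftrightarrow> (\<forall>r\<in>P. \<forall>r'\<in>P. heads r \<inter> heads r' \<noteq> {} \<longrightarrow> r = r')"

definition is_program :: "rule set \<Rightarrow> bool" where
  "is_program P \<longleftrightarrow> finite P \<and> (\<forall>r\<in>P. wf_rule r) \<and> acyclic (dependency P) \<and> definitorial P"

definition prog_vars :: "rule set \<Rightarrow> var set" where
  "prog_vars P = (\<Union>r\<in>P. heads r \<union> body_vars r)"

definition defined_vars :: "rule set \<Rightarrow> var set" where
  "defined_vars P = (\<Union>r\<in>P. heads r)"

definition input_vars :: "rule set \<Rightarrow> var set" where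
  "input_vars P = prog_vars P - defined_vars P"


section \<open>Semantics\<close>

definition input_at :: "var set list \<Rightarrow> nat \<Rightarrow> var set" where
  "input_at I t = (if 1 \<le> t \<and> t \<le> length I then I ! (t - 1) else {})"

lemma eval_form_cong [fundef_cong]:
  "\<alpha> = \<beta> \<Longrightarrow> (\<And>a. a \<in> fvars \<beta> \<Longrightarrow> v a = w a) \<Longrightarrow> eval_form v \<alpha> = eval_form w \<beta>"
  by (induction \<alpha> arbitrary: \<beta>) auto

definition dep_rank :: "rule set \<Rightarrow> var \<Rightarrow> nat" where
  "dep_rank P p = card {a. (a, p) \<in> (dependency P)\<^sup>+}"

lemma finite_dependency: "finite P \<Longrightarrow> finite (dependency P)"
proof -
  have "finite (fvars \<alpha>)" for \<alpha> by (induction \<alpha>) auto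
  then have "finite (body_vars r \<times> heads r)" for r by (cases r) auto
  then show "finite P \<Longrightarrow> finite (dependency P)" by (auto simp: dependency_def)
qed

lemma dep_rank_less:
  assumes "is_program P" "r \<in> P" "p \<in> heads r" "a \<in> body_vars r"
  shows "dep_rank P a < dep_rank P p"
  unfolding dep_rank_def
proof (rule psubset_card_mono)
  have "finite ((dependency P)\<^sup>+)"
    using assms(1) finite_dependency by (auto simp: is_program_def)
  then have "finite (fst ` (dependency P)\<^sup>+)" by simp
  then show "finite {b. (b, p) \<in> (dependency P)\<^sup>+}"
    by (rule rev_finite_subset) force
  have "(a, p) \<in> dependency P" using assms by (auto simp: dependency_def)
  moreover have "(a, a) \<notin> (dependency P)\<^sup>+"
    using assms(1) by (auto simp: is_program_def acyclic_def)
  ultimately show "{b. (b, a) \<in> (dependency P)\<^sup>+} \<subset> {b. (b, p) \<in> (dependency P)\<^sup>+}"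
    by (auto intro: trancl_into_trancl)
qed

lemma dep_rank_less_zip:
  assumes "is_program P" "Dynamic ps A as \<in> P" "p \<in> set ps" "(a, b) \<in> set (zip as \<sigma>)"
  shows "dep_rank P a < dep_rank P p"
  using dep_rank_less[OF assms(1,2)] assms(3,4) by (auto dest: set_zip_leftD)

text \<open>
  \<open>holds P I t p\<close> is \<open>(P, I, t) \<Turnstile> p\<close>. Time \<open>0\<close> precedes the first input: there all input variables
  are false and so are all variables defined by delay rules. The conjunct \<open>is_program P\<close> only
  serves termination. Since programs are definitorial, the rule chosen by the existential is unique.
  In \<open>Dynamic ps A as\<close> the state \<open>i\<close> is represented by \<open>ps ! (i - 1)\<close>.
\<close>

context
  notes conj_cong [fundef_cong]
begin

function (sequential) holds :: "rule set \<Rightarrow> var set list \<Rightarrow> nat \<Rightarrow> var \<Rightarrow> bool" where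
  "holds P I t p \<longleftrightarrow> is_program P \<and>
     (if p \<notin> defined_vars P then p \<in> input_at I t
      else \<exists>r\<in>P. p \<in> heads r \<and>
        (case r of
           Static _ \<alpha> \<Rightarrow> eval_form (\<lambda>a. holds P I t a) \<alpha>
         | Delay _ q \<Rightarrow> 0 < t \<and> holds P I (t - 1) q
         | Dynamic ps A as \<Rightarrow>
             (\<exists>i\<in>{1..nstates A}. p = ps ! (i - 1) \<and>
               (if t = 0 then q_init A = i
                else \<exists>j\<in>{1..nstates A}. \<exists>\<sigma>\<in>letters (arity A).
                  delta A j \<sigma> = i \<and> holds P I (t - 1) (ps ! (j - 1)) \<and>
                  (\<forall>l\<in>set (zip as \<sigma>). holds P I t (fst l) = snd l)))))"
  by pat_completeness auto
termination
  by (relation "measures [\<lambda>(P, I, t, p). t, \<lambda>(P, I, t, p). dep_rank P p]")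
     (auto intro: dep_rank_less dep_rank_less_zip)

end

declare holds.simps [simp del]


section \<open>Logics and expressivity\<close>

primrec uses_operators_from :: "op_automaton set \<Rightarrow> rule \<Rightarrow> bool" where
  "uses_operators_from \<A> (Static p \<alpha>) = True"
| "uses_operators_from \<A> (Delay p q) = True"
| "uses_operators_from \<A> (Dynamic ps A as) = (A \<in> \<A>)"

definition logic :: "op_automaton set \<Rightarrow> rule set set" where
  "logic \<A> = {P. is_program P \<and> (\<forall>r\<in>P. uses_operators_from \<A> r)}"

definition letter_vars :: "var list \<Rightarrow> bool list \<Rightarrow> var set" where
  "letter_vars vs \<sigma> = {vs ! k | k. k < length vs \<and> \<sigma> ! k}"

definition language_of :: "rule set \<Rightarrow> var list \<Rightarrow> var \<Rightarrow> bool list list set" where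
  "language_of P vs a =
     {w. w \<noteq> [] \<and> set w \<subseteq> letters (length vs) \<and> holds P (map (letter_vars vs) w) (length w) a}"

definition expressivity :: "rule set set \<Rightarrow> bool list list set set" where
  "expressivity L = {language_of P vs a | P vs a.
     P \<in> L \<and> distinct vs \<and> set vs = input_vars P \<and> a \<in> prog_vars P}"

definition logic_le :: "rule set set \<Rightarrow> rule set set \<Rightarrow> bool"  (infix "\<sqsubseteq>\<^sub>L" 50) where
  "L1 \<sqsubseteq>\<^sub>L L2 \<longleftrightarrow> expressivity L1 \<subseteq> expressivity L2"

definition logic_equiv :: "rule set set \<Rightarrow> rule set set \<Rightarrow> bool"  (infix "\<equiv>\<^sub>L" 50) where
  "L1 \<equiv>\<^sub>L L2 \<longleftrightarrow> L1 \<sqsubseteq>\<^sub>L L2 \<and> L2 \<sqsubseteq>\<^sub>L L1"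

end

theory Submission
  imports Defs
begin

text \<open>
  Every dynamic rule of a program can be replaced, one at a time, by static rules and two copies of
  a similar operator. Similar operators have the same transitions up to recoding letters and
  states, so the only obstacle is the initial state. For a group core, left translations commute
  with all transitions and act transitively on states, so the initial state is corrected by
  relabelling the output of one copy. For a flip-flop core, the second copy records whether a set or
  reset has occurred: before that the simulated operator is in its initial state, afterwards the
  initial state of the first copy has been forgotten.
\<close>

section \<open>Simulation of similar operators\<close>

text \<open>What is kept of a group core: \<open>\<theta>\<close> abstracts a left translation, so
  that relabelling the states of a run started in \<open>b\<close> yields the run started in
  \<open>a\<close>.\<close>

definition translation_transitive :: "op_automaton \<Rightarrow> bool" where
  "translation_transitive A \<longleftrightarrow>
     (\<forall>a\<in>{1..nstates A}. \<forall>b\<in>{1..nstates A}. \<exists>\<theta>. \<theta> b = a \<and> \<theta> ` {1..nstates A} \<subseteq> {1..nstates A} \<and>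
        (\<forall>q\<in>{1..nstates A}. \<forall>\<sigma>\<in>letters (arity A). \<theta> (delta A q \<sigma>) = delta A (\<theta> q) \<sigma>))"

text \<open>What is kept of a flip-flop core: every letter reads or overwrites. The letter
  \<open>\<kappa>\<close> overwrites with states other than \<open>b\<close>; it will signal that
  something has been written.\<close>

definition resettable :: "op_automaton \<Rightarrow> bool" where
  "resettable A \<longleftrightarrow>
     (\<forall>\<sigma>\<in>letters (arity A). (\<forall>q\<in>{1..nstates A}. delta A q \<sigma> = q) \<or>
        (\<exists>c. \<forall>q\<in>{1..nstates A}. delta A q \<sigma> = c)) \<and>
     (\<forall>b\<in>{1..nstates A}. \<exists>\<kappa>\<in>letters (arity A). \<forall>q\<in>{1..nstates A}. delta A q \<kappa> \<noteq> b)"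

text \<open>One shape for both kinds of core: two copies of \<open>B\<close> run in parallel on the
  recoded letters \<open>f \<sigma>\<close> and \<open>g \<sigma>\<close>, and \<open>h\<close>
  decodes their pair of states into a state of \<open>A\<close>.\<close>

definition simulated_by :: "op_automaton \<Rightarrow> op_automaton \<Rightarrow> bool" where
  "simulated_by A B \<longleftrightarrow> (\<exists>f g h.
     (\<forall>\<sigma>\<in>letters (arity A). f \<sigma> \<in> letters (arity B) \<and> g \<sigma> \<in> letters (arity B)) \<and>
     h (q_init B) (q_init B) = q_init A \<and>
     (\<forall>x\<in>{1..nstates B}. \<forall>y\<in>{1..nstates B}. h x y \<in> {1..nstates A} \<and>
        (\<forall>\<sigma>\<in>letters (arity A). h (delta B x (f \<sigma>)) (delta B y (g \<sigma>)) = delta A (h x y) \<sigma>)))"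

section \<open>Cores of group type and of flip-flop type\<close>

lemma core_step:
  assumes "is_core D A"
  obtains \<phi> where "\<phi> ` letters (arity A) = alphabet D" "states D = {1..nstates A}"
    "\<And>q \<sigma>. q \<in> {1..nstates A} \<Longrightarrow> \<sigma> \<in> letters (arity A) \<Longrightarrow> delta A q \<sigma> = step D q (\<phi> \<sigma>)"
proof -
  from assms obtain \<phi> where "\<phi> ` letters (arity A) = alphabet D"
    "sa_same (op_semiautomaton A) (sa_comp (letters (arity A)) \<phi> D)"
    by (auto simp: is_core_def)
  then show thesis
    using that[of \<phi>] by (simp add: sa_same_def op_semiautomaton_def sa_comp_def)
qed

text \<open>Letters act by right multiplication, so by associativity left multiplication commutes
  with every transition; inverses provide a left multiplication between any two states.\<close>

lemma core_group_translation_transitive: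
  assumes core: "is_core D A" and G: "group G" and iso: "sa_iso D (sa_of_monoid G)"
  shows "translation_transitive A"
  unfolding translation_transitive_def
proof (intro ballI)
  fix a b assume a: "a \<in> {1..nstates A}" and b: "b \<in> {1..nstates A}"
  interpret group G by fact
  from core obtain \<phi> where \<phi>: "\<phi> ` letters (arity A) = alphabet D" "states D = {1..nstates A}"
    "\<And>q \<sigma>. q \<in> {1..nstates A} \<Longrightarrow> \<sigma> \<in> letters (arity A) \<Longrightarrow> delta A q \<sigma> = step D q (\<phi> \<sigma>)"
    using core_step by blast
  from core have wf: "wf_semiautomaton D" by (simp add: is_core_def prime_semiautomaton_def)
  from iso obtain \<chi>1 \<chi>2 where \<chi>: "bij_betw \<chi>1 (alphabet D) (carrier G)"
    "bij_betw \<chi>2 (states D) (carrier G)"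
    "\<And>q s. q \<in> states D \<Longrightarrow> s \<in> alphabet D \<Longrightarrow> \<chi>2 (step D q s) = \<chi>2 q \<otimes>\<^bsub>G\<^esub> \<chi>1 s"
    unfolding sa_iso_def sa_of_monoid_def by (auto simp: insert_absorb)
  let ?S = "{1..nstates A}"
  have bij: "bij_betw \<chi>2 ?S (carrier G)" using \<chi>(2) \<phi>(2) by simp
  have car: "\<chi>2 q \<in> carrier G" if "q \<in> ?S" for q using that bij by (auto simp: bij_betw_def)
  \<comment> \<open>Left multiplication by \<open>g\<close> moves \<open>\<chi>2 b\<close> to
    \<open>\<chi>2 a\<close>; \<open>\<theta>\<close> is this translation carried over to the states
    of \<open>A\<close>.\<close>
  define g where "g = \<chi>2 a \<otimes>\<^bsub>G\<^esub> inv\<^bsub>G\<^esub> (\<chi>2 b)"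
  define \<theta> where "\<theta> q = inv_into ?S \<chi>2 (g \<otimes>\<^bsub>G\<^esub> \<chi>2 q)" for q
  have g: "g \<in> carrier G" using car a b by (simp add: g_def)
  have \<theta>S: "\<theta> q \<in> ?S" "\<chi>2 (\<theta> q) = g \<otimes>\<^bsub>G\<^esub> \<chi>2 q" if "q \<in> ?S" for q
  proof -
    have "g \<otimes>\<^bsub>G\<^esub> \<chi>2 q \<in> \<chi>2 ` ?S" using bij g car that by (auto simp: bij_betw_def)
    then show "\<theta> q \<in> ?S" "\<chi>2 (\<theta> q) = g \<otimes>\<^bsub>G\<^esub> \<chi>2 q"
      unfolding \<theta>_def by (auto simp only: inv_into_into f_inv_into_f)
  qed
  have inj: "x = y" if "\<chi>2 x = \<chi>2 y" "x \<in> ?S" "y \<in> ?S" for x y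
    using that bij by (auto simp: bij_betw_def dest: inj_onD)
  have "\<chi>2 (\<theta> b) = \<chi>2 a" using \<theta>S(2)[OF b] car a b by (simp add: g_def m_assoc)
  then have "\<theta> b = a" using inj \<theta>S(1) a b by blast
  moreover have "\<theta> (delta A q \<sigma>) = delta A (\<theta> q) \<sigma>" if q: "q \<in> ?S" and \<sigma>: "\<sigma> \<in> letters (arity A)" for q \<sigma>
  proof (rule inj)
    have l: "\<phi> \<sigma> \<in> alphabet D" using \<phi>(1) \<sigma> by auto
    have c1: "\<chi>1 (\<phi> \<sigma>) \<in> carrier G" using l \<chi>(1) by (auto simp: bij_betw_def)
    have d: "delta A x \<sigma> \<in> ?S" if "x \<in> ?S" for x
      using wf \<phi>(2,3) l \<sigma> that by (auto simp: wf_semiautomaton_def)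
    have s: "\<chi>2 (delta A x \<sigma>) = \<chi>2 x \<otimes>\<^bsub>G\<^esub> \<chi>1 (\<phi> \<sigma>)" if "x \<in> ?S" for x
      using \<phi>(2,3) \<chi>(3) l \<sigma> that by auto
    show "\<theta> (delta A q \<sigma>) \<in> ?S" "delta A (\<theta> q) \<sigma> \<in> ?S" using d \<theta>S(1) q by auto
    show "\<chi>2 (\<theta> (delta A q \<sigma>)) = \<chi>2 (delta A (\<theta> q) \<sigma>)"
      using s[OF q] s[OF \<theta>S(1)[OF q]] \<theta>S(2)[OF q] \<theta>S(2)[OF d[OF q]] g car[OF q] c1
      by (simp add: m_assoc)
  qed
  ultimately show "\<exists>\<theta>. \<theta> b = a \<and> \<theta> ` ?S \<subseteq> ?S \<and>
        (\<forall>q\<in>?S. \<forall>\<sigma>\<in>letters (arity A). \<theta> (delta A q \<sigma>) = delta A (\<theta> q) \<sigma>)"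
    using \<theta>S(1) by blast
qed

text \<open>The map \<open>k\<close> sends a letter of the flip-flop to the constant value it resets to, which
  covers the three-state and the two-state flip-flop at once.\<close>

lemma core_flipflop_resettable:
  fixes E :: "(flipflop, 'q) semiautomaton"
  assumes core: "is_core D A" and iso: "sa_iso D E" and alph: "alphabet E = UNIV"
    and id: "\<And>q. step E q FId = q"
    and const: "\<And>q. step E q FSet = k FSet" "\<And>q. step E q FReset = k FReset"
    and ne: "k FSet \<noteq> k FReset"
  shows "resettable A"
proof -
  from core obtain \<phi> where \<phi>: "\<phi> ` letters (arity A) = alphabet D" "states D = {1..nstates A}"
    "\<And>q \<sigma>. q \<in> {1..nstates A} \<Longrightarrow> \<sigma> \<in> letters (arity A) \<Longrightarrow> delta A q \<sigma> = step D q (\<phi> \<sigma>)"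
    using core_step by blast
  from core have wf: "wf_semiautomaton D" by (simp add: is_core_def prime_semiautomaton_def)
  from iso alph obtain \<chi>1 \<chi>2 where \<chi>: "bij_betw \<chi>1 (alphabet D) UNIV"
    "bij_betw \<chi>2 (states D) (states E)"
    "\<And>q s. q \<in> states D \<Longrightarrow> s \<in> alphabet D \<Longrightarrow> \<chi>2 (step D q s) = step E (\<chi>2 q) (\<chi>1 s)"
    unfolding sa_iso_def by auto
  let ?S = "{1..nstates A}"
  have l: "\<phi> \<sigma> \<in> alphabet D" if "\<sigma> \<in> letters (arity A)" for \<sigma> using \<phi>(1) that by auto
  have d: "delta A x \<sigma> \<in> ?S" if "x \<in> ?S" "\<sigma> \<in> letters (arity A)" for x \<sigma>
    using wf \<phi>(2,3) l that by (auto simp: wf_semiautomaton_def)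
  have s: "\<chi>2 (delta A x \<sigma>) = step E (\<chi>2 x) (\<chi>1 (\<phi> \<sigma>))" if "x \<in> ?S" "\<sigma> \<in> letters (arity A)" for x \<sigma>
    using \<phi>(2,3) \<chi>(3) l that by auto
  have inj: "x = y" if "\<chi>2 x = \<chi>2 y" "x \<in> ?S" "y \<in> ?S" for x y
    using that \<chi>(2) \<phi>(2) by (auto simp: bij_betw_def dest: inj_onD)
  have letter: "\<exists>\<sigma>\<in>letters (arity A). \<chi>1 (\<phi> \<sigma>) = u" for u
  proof -
    have "u \<in> \<chi>1 ` \<phi> ` letters (arity A)" using \<chi>(1) \<phi>(1) by (simp add: bij_betw_def)
    then show ?thesis by blast
  qed
  have "(\<forall>q\<in>?S. delta A q \<sigma> = q) \<or> (\<exists>c. \<forall>q\<in>?S. delta A q \<sigma> = c)" if \<sigma>: "\<sigma> \<in> letters (arity A)" for \<sigma>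
  proof (cases "\<chi>1 (\<phi> \<sigma>) = FId")
    case True
    then show ?thesis using s[OF _ \<sigma>] d[OF _ \<sigma>] inj by (auto simp: id)
  next
    case False
    then have "\<chi>2 (delta A x \<sigma>) = k (\<chi>1 (\<phi> \<sigma>))" if "x \<in> ?S" for x
      using s[OF that \<sigma>] const by (cases "\<chi>1 (\<phi> \<sigma>)") auto
    then have "delta A x \<sigma> = delta A y \<sigma>" if "x \<in> ?S" "y \<in> ?S" for x y
      using inj d \<sigma> that by metis
    then show ?thesis by metis
  qed
  moreover have "\<exists>\<kappa>\<in>letters (arity A). \<forall>q\<in>?S. delta A q \<kappa> \<noteq> b" for b
  proof -
    \<comment> \<open>Set and reset write different values, so at least one of them avoids
      \<open>b\<close>; surjectivity of \<open>\<phi>\<close> then yields a letter of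
      \<open>A\<close> acting this way.\<close>
    obtain u where u: "u \<in> {FSet, FReset}" "k u \<noteq> \<chi>2 b" using ne by (metis insertCI)
    obtain \<kappa> where \<kappa>: "\<kappa> \<in> letters (arity A)" "\<chi>1 (\<phi> \<kappa>) = u" using letter by blast
    have "\<chi>2 (delta A q \<kappa>) = k u" if "q \<in> ?S" for q
      using s[OF that \<kappa>(1)] \<kappa>(2) u(1) const by auto
    then show ?thesis using u(2) \<kappa>(1) by metis
  qed
  ultimately show ?thesis by (simp add: resettable_def)
qed

lemma core_translation_transitive_or_resettable:
  assumes "is_core D A"
  shows "translation_transitive A \<or> resettable A"
proof -
  have "prime_semiautomaton D" using assms by (simp add: is_core_def)
  then consider "sa_iso D (sa_of_monoid flipflop_monoid)" | "sa_iso D two_state_flipflop"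
    | G :: "nat monoid" where "is_simple_group G" "sa_iso D (sa_of_monoid G)"
    unfolding prime_semiautomaton_def by blast
  then show ?thesis
  proof cases
    case 1
    \<comment> \<open>In the flip-flop monoid the states are the letters themselves, and set and
      reset each write themselves.\<close>
    have "resettable A"
      by (rule core_flipflop_resettable[OF assms 1, where k = id])
         (auto simp: sa_of_monoid_def flipflop_monoid_def)
    then show ?thesis ..
  next
    case 2
    \<comment> \<open>Set and reset ignore the old state, so any state, here
      \<open>undefined\<close>, can be used to name the value written.\<close>
    have "resettable A"
      by (rule core_flipflop_resettable[OF assms 2, where k = "flipflop_step undefined"])
         (auto simp: two_state_flipflop_def)
    then show ?thesis ..
  next
    case 3
    then show ?thesis
      using core_group_translation_transitive[OF assms] by (auto simp: is_simple_group_def)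
  qed
qed

section \<open>Recoding along isomorphic cores\<close>

text \<open>Letters of \<open>A\<close> pass through the core isomorphism and are lifted to letters
  of \<open>B\<close>, whose input function is surjective. States go the opposite way, through the
  inverse isomorphism, since it is the states of \<open>B\<close> that have to be decoded.\<close>

lemma similar_recoding:
  assumes "similar A B"
  obtains f \<eta> where "\<And>\<sigma>. \<sigma> \<in> letters (arity A) \<Longrightarrow> f \<sigma> \<in> letters (arity B)"
    "\<And>x. x \<in> {1..nstates B} \<Longrightarrow> \<eta> x \<in> {1..nstates A}"
    "inj_on \<eta> {1..nstates B}"
    "\<And>x \<sigma>. x \<in> {1..nstates B} \<Longrightarrow> \<sigma> \<in> letters (arity A) \<Longrightarrow>
       \<eta> (delta B x (f \<sigma>)) = delta A (\<eta> x) \<sigma>"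
proof -
  from assms obtain D E where D: "is_core D A" and E: "is_core E B" and iso: "sa_iso D E"
    by (auto simp: similar_def)
  from D obtain \<phi> where \<phi>: "\<phi> ` letters (arity A) = alphabet D" "states D = {1..nstates A}"
    "\<And>q \<sigma>. q \<in> {1..nstates A} \<Longrightarrow> \<sigma> \<in> letters (arity A) \<Longrightarrow> delta A q \<sigma> = step D q (\<phi> \<sigma>)"
    using core_step by blast
  from E obtain \<chi> where \<chi>: "\<chi> ` letters (arity B) = alphabet E" "states E = {1..nstates B}"
    "\<And>q \<sigma>. q \<in> {1..nstates B} \<Longrightarrow> \<sigma> \<in> letters (arity B) \<Longrightarrow> delta B q \<sigma> = step E q (\<chi> \<sigma>)"
    using core_step by blast
  from D have wf: "wf_semiautomaton D" by (simp add: is_core_def prime_semiautomaton_def)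
  from iso obtain \<psi>1 \<psi>2 where \<psi>: "bij_betw \<psi>1 (alphabet D) (alphabet E)"
    "bij_betw \<psi>2 (states D) (states E)"
    "\<And>q s. q \<in> states D \<Longrightarrow> s \<in> alphabet D \<Longrightarrow> \<psi>2 (step D q s) = step E (\<psi>2 q) (\<psi>1 s)"
    unfolding sa_iso_def by auto
  \<comment> \<open>\<open>\<chi>\<close> may merge letters of \<open>B\<close>; any preimage does,
    because merged letters act alike.\<close>
  define f where "f \<sigma> = inv_into (letters (arity B)) \<chi> (\<psi>1 (\<phi> \<sigma>))" for \<sigma>
  define \<eta> where "\<eta> = inv_into (states D) \<psi>2"
  have f: "f \<sigma> \<in> letters (arity B)" "\<chi> (f \<sigma>) = \<psi>1 (\<phi> \<sigma>)" if "\<sigma> \<in> letters (arity A)" for \<sigma>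
  proof -
    have "\<phi> \<sigma> \<in> alphabet D" using that \<phi>(1) by auto
    then have "\<psi>1 (\<phi> \<sigma>) \<in> \<chi> ` letters (arity B)"
      using \<psi>(1) \<chi>(1) by (auto simp: bij_betw_def)
    then show "f \<sigma> \<in> letters (arity B)" "\<chi> (f \<sigma>) = \<psi>1 (\<phi> \<sigma>)"
      unfolding f_def by (auto simp only: inv_into_into f_inv_into_f)
  qed
  have \<eta>: "bij_betw \<eta> (states E) (states D)"
    unfolding \<eta>_def using \<psi>(2) by (rule bij_betw_inv_into)
  have \<eta>S: "\<eta> x \<in> states D" "\<psi>2 (\<eta> x) = x" if "x \<in> states E" for x
    using that \<eta> bij_betw_inv_into_right[OF \<psi>(2)] by (auto simp: \<eta>_def bij_betw_def)
  show thesis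
  proof (rule that)
    show "f \<sigma> \<in> letters (arity B)" if "\<sigma> \<in> letters (arity A)" for \<sigma> using f(1) that .
    show "\<eta> x \<in> {1..nstates A}" if "x \<in> {1..nstates B}" for x using \<eta>S(1) that \<phi>(2) \<chi>(2) by simp
    show "inj_on \<eta> {1..nstates B}" using \<eta> \<chi>(2) by (simp add: bij_betw_def)
    show "\<eta> (delta B x (f \<sigma>)) = delta A (\<eta> x) \<sigma>"
      if x: "x \<in> {1..nstates B}" and \<sigma>: "\<sigma> \<in> letters (arity A)" for x \<sigma>
    proof -
      have xE: "x \<in> states E" using x \<chi>(2) by simp
      have l: "\<phi> \<sigma> \<in> alphabet D" using \<phi>(1) \<sigma> by auto
      have "delta B x (f \<sigma>) = \<psi>2 (step D (\<eta> x) (\<phi> \<sigma>))"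
        using \<chi>(3)[OF x f(1)[OF \<sigma>]] f(2)[OF \<sigma>] \<psi>(3)[OF \<eta>S(1)[OF xE] l] \<eta>S(2)[OF xE] by simp
      \<comment> \<open>\<open>inv_into\<close> cancels \<open>\<psi>2\<close> only on
        \<open>states D\<close>, so the step has to stay there.\<close>
      moreover have "step D (\<eta> x) (\<phi> \<sigma>) \<in> states D"
        using wf \<eta>S(1)[OF xE] l by (simp add: wf_semiautomaton_def)
      ultimately have "\<eta> (delta B x (f \<sigma>)) = step D (\<eta> x) (\<phi> \<sigma>)"
        unfolding \<eta>_def using bij_betw_inv_into_left[OF \<psi>(2)] by simp
      then show ?thesis using \<phi>(2,3) \<eta>S(1)[OF xE] \<sigma> by simp
    qed
  qed
qed

text \<open>The transitions already match through \<open>f\<close> and \<open>\<eta>\<close>; the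
  two cases differ only in how the decoding is made to start in \<open>q_init A\<close>.\<close>

lemma similar_simulated_by:
  assumes sim: "similar A B" and A: "wf_operator A" and B: "wf_operator B"
  shows "simulated_by A B"
proof -
  let ?SA = "{1..nstates A}" and ?SB = "{1..nstates B}"
  from sim obtain f \<eta> where f: "\<And>\<sigma>. \<sigma> \<in> letters (arity A) \<Longrightarrow> f \<sigma> \<in> letters (arity B)"
    and \<eta>: "\<And>x. x \<in> ?SB \<Longrightarrow> \<eta> x \<in> ?SA" and inj: "inj_on \<eta> ?SB"
    and hom: "\<And>x \<sigma>. x \<in> ?SB \<Longrightarrow> \<sigma> \<in> letters (arity A) \<Longrightarrow> \<eta> (delta B x (f \<sigma>)) = delta A (\<eta> x) \<sigma>"
    using similar_recoding by blast
  have initA: "q_init A \<in> ?SA" and initB: "q_init B \<in> ?SB"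
    using A B by (auto simp only: wf_operator_def)
  have dA: "delta A q \<sigma> \<in> ?SA" if "q \<in> ?SA" "\<sigma> \<in> letters (arity A)" for q \<sigma>
    using A that by (simp only: wf_operator_def)
  have dB: "delta B q \<sigma> \<in> ?SB" if "q \<in> ?SB" "\<sigma> \<in> letters (arity B)" for q \<sigma>
    using B that by (simp only: wf_operator_def)
  have "translation_transitive A \<or> resettable A"
    using sim core_translation_transitive_or_resettable by (auto simp: similar_def)
  then show ?thesis
  proof
    assume "translation_transitive A"
    then obtain \<theta> where \<theta>: "\<theta> (\<eta> (q_init B)) = q_init A" "\<theta> ` ?SA \<subseteq> ?SA"
      "\<forall>q\<in>?SA. \<forall>\<sigma>\<in>letters (arity A). \<theta> (delta A q \<sigma>) = delta A (\<theta> q) \<sigma>"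
      unfolding translation_transitive_def using initA \<eta>[OF initB] by meson
    show ?thesis
      unfolding simulated_by_def
    \<comment> \<open>\<open>exI[of _ f]\<close> fires twice, for \<open>f\<close> and for
      \<open>g\<close>: both copies get the same letters, and the decoding discards the second
      state.\<close>
    proof (intro exI[of _ f] exI[of _ "\<lambda>x _. \<theta> (\<eta> x)"] conjI ballI)
      fix x \<sigma> assume x: "x \<in> ?SB"
      then show "\<theta> (\<eta> x) \<in> ?SA" using \<eta> \<theta>(2) by blast
      assume \<sigma>: "\<sigma> \<in> letters (arity A)"
      show "\<theta> (\<eta> (delta B x (f \<sigma>))) = delta A (\<theta> (\<eta> x)) \<sigma>"
        using hom[OF x \<sigma>] \<theta>(3) \<eta>[OF x] \<sigma> by simp
    qed (use f \<theta>(1) in auto)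
  next
    assume reset: "resettable A"
    let ?b = "q_init B"
    let ?read = "\<lambda>\<sigma>. \<forall>q\<in>?SA. delta A q \<sigma> = q"
    \<comment> \<open>No transition of \<open>A\<close> under \<open>\<kappa>\<close> ends in the
      decoded initial state of \<open>B\<close>; hence \<open>f \<kappa>\<close> never leads
      \<open>B\<close> into \<open>?b\<close>.\<close>
    from reset obtain \<kappa> where \<kappa>: "\<kappa> \<in> letters (arity A)"
      "\<And>q. q \<in> ?SA \<Longrightarrow> delta A q \<kappa> \<noteq> \<eta> ?b"
      unfolding resettable_def using \<eta>[OF initB] by meson
    \<comment> \<open>The second copy receives reads as reads and every other letter as
      \<open>\<kappa>\<close>. It is in \<open>?b\<close> exactly as long as only reads have
      occurred, and \<open>h\<close> uses it as this flag.\<close>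
    define g where "g \<sigma> = (if ?read \<sigma> then f \<sigma> else f \<kappa>)" for \<sigma>
    define h where "h x y = (if y = ?b then q_init A else \<eta> x)" for x y
    have g: "g \<sigma> \<in> letters (arity B)" if "\<sigma> \<in> letters (arity A)" for \<sigma>
      using f \<kappa>(1) that by (simp add: g_def)
    show ?thesis
      unfolding simulated_by_def
    proof (rule exI[of _ f], rule exI[of _ g], rule exI[of _ h], intro conjI ballI)
      fix x y \<sigma> assume x: "x \<in> ?SB" and y: "y \<in> ?SB"
      show "h x y \<in> ?SA" using initA \<eta>[OF x] by (simp add: h_def)
      assume \<sigma>: "\<sigma> \<in> letters (arity A)"
      show "h (delta B x (f \<sigma>)) (delta B y (g \<sigma>)) = delta A (h x y) \<sigma>"
      proof (cases "?read \<sigma>")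
        case True
        \<comment> \<open>A read of \<open>A\<close> fixes \<open>\<eta> y\<close>; as
          \<open>\<eta>\<close> is injective, the second copy itself does not move and the flag
          keeps its value.\<close>
        have "\<eta> (delta B y (g \<sigma>)) = \<eta> y"
          using hom[OF y \<sigma>] True \<eta>[OF y] by (simp add: g_def)
        then have "delta B y (g \<sigma>) = y"
          using inj dB[OF y g[OF \<sigma>]] y by (simp add: inj_on_eq_iff)
        then show ?thesis using hom[OF x \<sigma>] True initA \<eta>[OF x] by (auto simp: h_def)
      next
        case False
        then obtain c where c: "\<And>q. q \<in> ?SA \<Longrightarrow> delta A q \<sigma> = c"
          using reset \<sigma> unfolding resettable_def by blast
        have "g \<sigma> = f \<kappa>" unfolding g_def using False by (rule if_not_P)
        then have "\<eta> (delta B y (g \<sigma>)) \<noteq> \<eta> ?b"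
          using hom[OF y \<kappa>(1)] \<kappa>(2)[OF \<eta>[OF y]] by simp
        then have "delta B y (g \<sigma>) \<noteq> ?b" by auto
        \<comment> \<open>The letter sends \<open>q_init A\<close> and \<open>\<eta> x\<close> to
          the same state \<open>c\<close>, so the decoding may switch to the first copy at this
          moment.\<close>
        then show ?thesis using hom[OF x \<sigma>] c initA \<eta>[OF x] by (simp add: h_def)
      qed
    qed (use f g in \<open>auto simp: h_def\<close>)
  qed
qed


section \<open>Programs as systems of equations\<close>

text \<open>The letter at time \<open>Suc t\<close> leads into the state at time
  \<open>Suc t\<close>, which is the timing of dynamic rules: new state and letter belong to the
  same instant.\<close>

primrec op_run :: "op_automaton \<Rightarrow> (nat \<Rightarrow> bool list) \<Rightarrow> nat \<Rightarrow> nat" where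
  "op_run A x 0 = q_init A"
| "op_run A x (Suc t) = delta A (op_run A x t) (x (Suc t))"

lemma op_run_in_states:
  assumes "wf_operator A" "\<And>t. x t \<in> letters (arity A)"
  shows "op_run A x t \<in> {1..nstates A}"
proof (induction t)
  case 0
  show ?case using assms(1) by (simp only: wf_operator_def op_run.simps)
next
  case (Suc t)
  show ?case using assms Suc by (simp only: wf_operator_def op_run.simps)
qed

lemma op_run_cong: "(\<And>s. s \<le> t \<Longrightarrow> x s = y s) \<Longrightarrow> op_run A x t = op_run A y t"
  by (induction t) auto

text \<open>Rules as equations on a valuation over all times. No program is mentioned, so the
  valuation computed by one program can be tested against the rules of another. List position
  \<open>i\<close> stands for state \<open>Suc i\<close>.\<close>

primrec satisfies :: "(nat \<Rightarrow> var \<Rightarrow> bool) \<Rightarrow> rule \<Rightarrow> bool" where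
  "satisfies v (Static p \<alpha>) \<longleftrightarrow> (\<forall>t. v t p = eval_form (v t) \<alpha>)"
| "satisfies v (Delay p q) \<longleftrightarrow> (\<forall>t. v t p = (0 < t \<and> v (t - 1) q))"
| "satisfies v (Dynamic ps A as) \<longleftrightarrow>
     (\<forall>t. \<forall>i<length ps. v t (ps ! i) = (op_run A (\<lambda>t. map (v t) as) t = Suc i))"

lemma holds_input:
  "is_program P \<Longrightarrow> p \<notin> defined_vars P \<Longrightarrow> holds P I t p \<longleftrightarrow> p \<in> input_at I t"
  by (subst holds.simps) simp

lemma head_unique: "is_program P \<Longrightarrow> r \<in> P \<Longrightarrow> p \<in> heads r \<Longrightarrow> r' \<in> P \<Longrightarrow> p \<in> heads r' \<Longrightarrow> r' = r"
  unfolding is_program_def definitorial_def by blast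

lemma holds_defined:
  assumes "is_program P" "r \<in> P" "p \<in> heads r"
  shows "holds P I t p \<longleftrightarrow>
    (case r of
       Static _ \<alpha> \<Rightarrow> eval_form (\<lambda>a. holds P I t a) \<alpha>
     | Delay _ q \<Rightarrow> 0 < t \<and> holds P I (t - 1) q
     | Dynamic ps A as \<Rightarrow>
         (\<exists>i\<in>{1..nstates A}. p = ps ! (i - 1) \<and>
           (if t = 0 then q_init A = i
            else \<exists>j\<in>{1..nstates A}. \<exists>\<sigma>\<in>letters (arity A).
              delta A j \<sigma> = i \<and> holds P I (t - 1) (ps ! (j - 1)) \<and>
              (\<forall>l\<in>set (zip as \<sigma>). holds P I t (fst l) = snd l))))"
    (is "_ \<longleftrightarrow> ?R r")
proof -
  have "p \<in> defined_vars P" using assms by (auto simp: defined_vars_def)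
  then have "holds P I t p \<longleftrightarrow> (\<exists>r\<in>P. p \<in> heads r \<and> ?R r)"
    using assms(1) by (subst holds.simps) simp
  also have "\<dots> \<longleftrightarrow> ?R r" using assms head_unique by blast
  finally show ?thesis .
qed

lemma zip_eq_map_iff:
  "length as = length \<sigma> \<Longrightarrow> (\<forall>l\<in>set (zip as \<sigma>). v (fst l) = snd l) \<longleftrightarrow> \<sigma> = map v as"
  by (induction as \<sigma> rule: list_induct2) auto

section \<open>Existence and uniqueness of solutions\<close>

text \<open>For a dynamic rule, by induction on time, exactly one state variable is true and exactly
  one letter fits the arguments, so the existentials over \<open>j\<close> and
  \<open>\<sigma>\<close> collapse to the run.\<close>

lemma holds_satisfies:
  assumes P: "is_program P" and r: "r \<in> P"
  shows "satisfies (holds P I) r"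
proof (cases r)
  case (Static p \<alpha>)
  then show ?thesis using holds_defined[OF P r] by simp
next
  case (Delay p q)
  then show ?thesis using holds_defined[OF P r] by simp
next
  case (Dynamic ps A as)
  have wf: "wf_operator A" "length ps = nstates A" "distinct ps" "length as = arity A"
    using P r Dynamic by (auto simp: is_program_def)
  let ?x = "\<lambda>t. map (holds P I t) as"
  have x: "?x t \<in> letters (arity A)" for t using wf by (simp add: letters_def)
  have index: "(ps ! i = ps ! (i' - 1)) = (i' = Suc i)" if "i < length ps" "i' \<in> {1..nstates A}" for i i'
    using that wf(2,3) by (auto simp: nth_eq_iff_index_eq)
  have "\<forall>i<length ps. holds P I t (ps ! i) = (op_run A ?x t = Suc i)" for t
  proof (induction t)
    case 0
    show ?case
    proof (intro allI impI)
      fix i assume i: "i < length ps"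
      then have "ps ! i \<in> heads r" using Dynamic by simp
      from holds_defined[OF P r this, of I 0]
      show "holds P I 0 (ps ! i) = (op_run A ?x 0 = Suc i)"
        using i index[OF i] wf(2) by (auto simp: Dynamic)
    qed
  next
    case (Suc t)
    show ?case
    proof (intro allI impI)
      fix i assume i: "i < length ps"
      then have "ps ! i \<in> heads r" using Dynamic by simp
      from holds_defined[OF P r this, of I "Suc t"]
      have "holds P I (Suc t) (ps ! i) \<longleftrightarrow> (\<exists>i'\<in>{1..nstates A}. ps ! i = ps ! (i' - 1) \<and>
         (\<exists>j\<in>{1..nstates A}. \<exists>\<sigma>\<in>letters (arity A).
              delta A j \<sigma> = i' \<and> holds P I t (ps ! (j - 1)) \<and>
              (\<forall>l\<in>set (zip as \<sigma>). holds P I (Suc t) (fst l) = snd l)))"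
        by (simp add: Dynamic)
      also have "\<dots> \<longleftrightarrow> (\<exists>j\<in>{1..nstates A}. \<exists>\<sigma>\<in>letters (arity A).
              delta A j \<sigma> = Suc i \<and> holds P I t (ps ! (j - 1)) \<and>
              (\<forall>l\<in>set (zip as \<sigma>). holds P I (Suc t) (fst l) = snd l))"
      proof -
        have "Suc i \<in> {1..nstates A}" using i wf(2) by simp
        then show ?thesis using index[OF i] by blast
      qed
      also have "\<dots> \<longleftrightarrow> (\<exists>j\<in>{1..nstates A}. \<exists>\<sigma>\<in>letters (arity A).
              delta A j \<sigma> = Suc i \<and> op_run A ?x t = j \<and> \<sigma> = ?x (Suc t))"
      proof (intro bex_cong refl)
        fix j \<sigma> assume j: "j \<in> {1..nstates A}" and \<sigma>: "\<sigma> \<in> letters (arity A)"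
        have "holds P I t (ps ! (j - 1)) = (op_run A ?x t = j)"
          using Suc j wf(2) by auto
        moreover have "(\<forall>l\<in>set (zip as \<sigma>). holds P I (Suc t) (fst l) = snd l) = (\<sigma> = ?x (Suc t))"
          using \<sigma> wf(4) by (intro zip_eq_map_iff) (simp add: letters_def)
        ultimately show "(delta A j \<sigma> = Suc i \<and> holds P I t (ps ! (j - 1)) \<and>
              (\<forall>l\<in>set (zip as \<sigma>). holds P I (Suc t) (fst l) = snd l)) =
            (delta A j \<sigma> = Suc i \<and> op_run A ?x t = j \<and> \<sigma> = ?x (Suc t))" by simp
      qed
      also have "\<dots> \<longleftrightarrow> op_run A ?x (Suc t) = Suc i"
        using op_run_in_states[of A ?x t, OF wf(1) x] x[of "Suc t"] by auto
      finally show "holds P I (Suc t) (ps ! i) = (op_run A ?x (Suc t) = Suc i)" .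
    qed
  qed
  then show ?thesis by (simp add: Dynamic)
qed

text \<open>Outer induction on time, inner induction on \<open>dep_rank\<close>. This reduces the
  comparison of two programs to checking that both valuations solve the equations of one of
  them.\<close>

lemma satisfies_unique:
  assumes P: "is_program P"
    and v: "\<And>r. r \<in> P \<Longrightarrow> satisfies v r" and w: "\<And>r. r \<in> P \<Longrightarrow> satisfies w r"
    and input: "\<And>t p. p \<in> input_vars P \<Longrightarrow> v t p = w t p"
  shows "p \<in> prog_vars P \<Longrightarrow> v t p = w t p"
proof (induction t arbitrary: p rule: less_induct)
  case (less t)
  note earlier = less.IH
  from less.prems show ?case
  proof (induction p rule: measure_induct_rule[of "dep_rank P"])
    case (less p)
    show ?case
    proof (cases "p \<in> defined_vars P")
      case False
      then show ?thesis using less.prems input by (simp add: input_vars_def)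
    next
      case True
      then obtain r where r: "r \<in> P" "p \<in> heads r" by (auto simp: defined_vars_def)
      \<comment> \<open>All times up to \<open>t\<close> are covered because a run depends on the
        whole history of its arguments: time \<open>t\<close> follows by rank, earlier times by the
        outer induction.\<close>
      have body: "v s a = w s a" if "a \<in> body_vars r" "s \<le> t" for a s
      proof -
        have a: "a \<in> prog_vars P" using that(1) r by (auto simp: prog_vars_def)
        show ?thesis
        proof (cases "s = t")
          case True
          then show ?thesis using less.IH[OF dep_rank_less[OF P r that(1)] a] by simp
        qed (use earlier a that(2) in auto)
      qed
      show ?thesis
      proof (cases r)
        case (Static q \<alpha>)
        have "eval_form (v t) \<alpha> = eval_form (w t) \<alpha>"
          using body Static by (intro eval_form_cong) auto
        then show ?thesis using v[OF r(1)] w[OF r(1)] r(2) Static by simp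
      next
        case (Delay q q')
        then show ?thesis using v[OF r(1)] w[OF r(1)] r(2) body[of q' "t - 1"] by simp
      next
        case (Dynamic ps A as)
        obtain i where i: "i < length ps" "p = ps ! i"
          using r(2) Dynamic by (auto simp: in_set_conv_nth)
        have "op_run A (\<lambda>t. map (v t) as) t = op_run A (\<lambda>t. map (w t) as) t"
          using body Dynamic by (intro op_run_cong) auto
        then show ?thesis using v[OF r(1)] w[OF r(1)] i Dynamic by simp
      qed
    qed
  qed
qed


section \<open>Blocks of static rules\<close>

text \<open>Shannon expansion; every variable of the list occurs, even when it is irrelevant.\<close>

primrec bool_form :: "var list \<Rightarrow> (bool list \<Rightarrow> bool) \<Rightarrow> form" where
  "bool_form [] F = (if F [] then Top else Bot)"
| "bool_form (a # as) F =
     Or (And (Var a) (bool_form as (\<lambda>\<sigma>. F (True # \<sigma>))))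
        (And (Neg (Var a)) (bool_form as (\<lambda>\<sigma>. F (False # \<sigma>))))"

lemma fvars_bool_form [simp]: "fvars (bool_form as F) = set as"
  by (induction as arbitrary: F) auto

lemma eval_bool_form [simp]: "eval_form v (bool_form as F) = F (map v as)"
proof (induction as arbitrary: F)
  case (Cons a as)
  then show ?case by (cases "v a") simp_all
qed simp

text \<open>A circuit with one static rule per output; \<open>F\<close> is meant to return one bit
  for each head.\<close>

definition static_block :: "var list \<Rightarrow> (bool list \<Rightarrow> bool list) \<Rightarrow> var list \<Rightarrow> rule set" where
  "static_block hs F as = (\<lambda>k. Static (hs ! k) (bool_form as (\<lambda>\<sigma>. F \<sigma> ! k))) ` {..<length hs}"

lemma static_block_satisfies:
  assumes "\<And>r. r \<in> static_block hs F as \<Longrightarrow> satisfies v r" "k < length hs"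
  shows "v t (hs ! k) = F (map (v t) as) ! k"
  using assms(1)[of "Static (hs ! k) (bool_form as (\<lambda>\<sigma>. F \<sigma> ! k))"] assms(2)
  by (auto simp: static_block_def)

lemma defined_vars_static_block: "defined_vars (static_block hs F as) = set hs"
  by (auto simp: defined_vars_def static_block_def in_set_conv_nth)

text \<open>An empty block has no rules and mentions none of \<open>as\<close>. This does occur, for
  the recoding into an operator of arity 0, where only the inclusion proved next is
  available.\<close>

lemma prog_vars_static_block:
  "hs \<noteq> [] \<Longrightarrow> prog_vars (static_block hs F as) = set hs \<union> set as"
  by (fastforce simp: prog_vars_def static_block_def in_set_conv_nth)

lemma prog_vars_static_block_subset:
  "prog_vars (static_block hs F as) \<subseteq> set hs \<union> set as"
  by (auto simp: prog_vars_def static_block_def)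

lemma dependency_static_block: "dependency (static_block hs F as) \<subseteq> set as \<times> set hs"
  by (auto simp: dependency_def static_block_def)

lemma definitorial_static_block: "distinct hs \<Longrightarrow> definitorial (static_block hs F as)"
  by (auto simp: definitorial_def static_block_def nth_eq_iff_index_eq)

section \<open>Unions of rule sets\<close>

lemma definitorial_Un:
  "definitorial P \<Longrightarrow> definitorial Q \<Longrightarrow> defined_vars P \<inter> defined_vars Q = {} \<Longrightarrow>
    definitorial (P \<union> Q)"
  unfolding definitorial_def defined_vars_def by blast

lemma dependency_Un: "dependency (P \<union> Q) = dependency P \<union> dependency Q"
  by (auto simp: dependency_def)

lemma defined_vars_Un: "defined_vars (P \<union> Q) = defined_vars P \<union> defined_vars Q"
  by (auto simp: defined_vars_def)

lemma prog_vars_Un: "prog_vars (P \<union> Q) = prog_vars P \<union> prog_vars Q"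
  by (auto simp: prog_vars_def)

lemma finite_prog_vars: "finite P \<Longrightarrow> finite (prog_vars P)"
proof -
  have "finite (fvars \<alpha>)" for \<alpha> by (induction \<alpha>) auto
  then have "finite (heads r \<union> body_vars r)" for r by (cases r) auto
  then show "finite P \<Longrightarrow> finite (prog_vars P)" by (auto simp: prog_vars_def)
qed


section \<open>Replacing a dynamic rule\<close>

text \<open>Induction on time: the single-step equation applies because both copies stay in proper
  states of \<open>B\<close>.\<close>

lemma simulation_run:
  assumes B: "wf_operator B" and x: "\<And>t. x t \<in> letters (arity A)"
    and fg: "\<And>\<sigma>. \<sigma> \<in> letters (arity A) \<Longrightarrow> f \<sigma> \<in> letters (arity B) \<and> g \<sigma> \<in> letters (arity B)"
    and init: "h (q_init B) (q_init B) = q_init A"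
    and step: "\<And>p q \<sigma>. p \<in> {1..nstates B} \<Longrightarrow> q \<in> {1..nstates B} \<Longrightarrow> \<sigma> \<in> letters (arity A) \<Longrightarrow>
       h (delta B p (f \<sigma>)) (delta B q (g \<sigma>)) = delta A (h p q) \<sigma>"
  shows "h (op_run B (f \<circ> x) t) (op_run B (g \<circ> x) t) = op_run A x t"
proof (induction t)
  case (Suc t)
  have "op_run B (f \<circ> x) t \<in> {1..nstates B}" "op_run B (g \<circ> x) t \<in> {1..nstates B}"
    using op_run_in_states[OF B] fg x by auto
  from step[OF this x[of "Suc t"]] show ?case using Suc by (simp add: comp_def)
qed (simp add: init)

text \<open>Tripling the ranks leaves room for the two layers \<open>X\<close> and \<open>Y\<close> just below the heads of \<open>r\<close>.\<close>

lemma acyclic_dependency_refine: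
  assumes P: "is_program P" and r: "r \<in> P"
    and fresh: "X \<inter> prog_vars P = {}" "Y \<inter> prog_vars P = {}" "X \<inter> Y = {}"
    and D: "D \<subseteq> dependency P \<union> body_vars r \<times> X \<union> X \<times> Y \<union> Y \<times> heads r"
  shows "acyclic D"
proof -
  have finb: "finite (body_vars r)"
  proof -
    have "finite (prog_vars P)" using P finite_prog_vars by (simp add: is_program_def)
    then show ?thesis by (rule rev_finite_subset) (use r in \<open>auto simp: prog_vars_def\<close>)
  qed
  \<comment> \<open>The least rank above all body variables; inserting 0 covers an empty
    body.\<close>
  define M where "M = Max (insert 0 (Suc ` dep_rank P ` body_vars r))"
  have M_ge: "dep_rank P a < M" if "a \<in> body_vars r" for a
  proof -
    have "Suc (dep_rank P a) \<le> M" unfolding M_def using that finb by (intro Max_ge) auto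
    then show ?thesis by simp
  qed
  have M_le: "M \<le> dep_rank P p" if "p \<in> heads r" for p
    unfolding M_def using finb dep_rank_less[OF P r that] by (auto intro: Max.boundedI Suc_leI)
  \<comment> \<open>Body variables have rank below \<open>M\<close>, hence value at most
    \<open>3 * M - 1\<close>; heads have rank at least \<open>M\<close>, hence value at least
    \<open>3 * M + 2\<close>. The values of \<open>X\<close> and \<open>Y\<close> lie strictly
    between.\<close>
  define \<rho> where "\<rho> a = (if a \<in> X then 3 * M else if a \<in> Y then 3 * M + 1 else 3 * dep_rank P a + 2)" for a
  have old: "\<rho> a = 3 * dep_rank P a + 2" if "a \<in> prog_vars P" for a
    using that fresh by (auto simp: \<rho>_def)
  have hb: "heads r \<subseteq> prog_vars P" "body_vars r \<subseteq> prog_vars P" using r by (auto simp: prog_vars_def)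
  have "D \<subseteq> measure \<rho>"
  proof
    fix e assume e: "e \<in> D"
    obtain a b where ab: "e = (a, b)" by (cases e)
    from e ab D consider "(a, b) \<in> dependency P" | "a \<in> body_vars r" "b \<in> X"
      | "a \<in> X" "b \<in> Y" | "a \<in> Y" "b \<in> heads r" by blast
    then have "\<rho> a < \<rho> b"
    proof cases
      case 1
      then obtain r' where r': "r' \<in> P" "a \<in> body_vars r'" "b \<in> heads r'" by (auto simp: dependency_def)
      then have "a \<in> prog_vars P" "b \<in> prog_vars P" by (auto simp: prog_vars_def)
      then show ?thesis using old dep_rank_less[OF P r'(1,3,2)] by simp
    next
      case 2
      then have "a \<in> prog_vars P" using hb by blast
      then show ?thesis using old[of a] 2 M_ge[of a] by (simp add: \<rho>_def[of b])
    next
      case 3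
      then show ?thesis using fresh by (auto simp: \<rho>_def)
    next
      case 4
      then have "\<rho> a = 3 * M + 1" using fresh by (auto simp: \<rho>_def)
      then show ?thesis using 4 old[of b] hb M_le[of b] by auto
    qed
    then show "e \<in> measure \<rho>" using ab by simp
  qed
  then show ?thesis by (meson acyclic_subset wf_acyclic wf_measure)
qed

text \<open>\<open>N\<close> has three layers: static rules recoding the letters, two copies of
  \<open>B\<close>, and static rules decoding into the old heads \<open>ps\<close>. Old variables
  keep their values because the new valuation still solves the equation of the removed rule.\<close>

lemma replace_rule:
  assumes P: "is_program P" and r: "Dynamic ps A as \<in> P"
    and B: "wf_operator B" and sim: "simulated_by A B"
  shows "\<exists>N. is_program (P - {Dynamic ps A as} \<union> N) \<and> (\<forall>r\<in>N. uses_operators_from {B} r) \<and>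
    input_vars (P - {Dynamic ps A as} \<union> N) = input_vars P \<and>
    prog_vars P \<subseteq> prog_vars (P - {Dynamic ps A as} \<union> N) \<and>
    (\<forall>I t. \<forall>p\<in>prog_vars P. holds (P - {Dynamic ps A as} \<union> N) I t p = holds P I t p)"
proof -
  define r where "r = Dynamic ps A as"
  have rP: "r \<in> P" using assms(2) by (simp add: r_def)
  have A: "wf_operator A" "length ps = nstates A" "distinct ps" "length as = arity A"
    using P rP by (auto simp: is_program_def r_def)
  from sim obtain f g h where
    fg: "\<And>\<sigma>. \<sigma> \<in> letters (arity A) \<Longrightarrow> f \<sigma> \<in> letters (arity B) \<and> g \<sigma> \<in> letters (arity B)"
    and init: "h (q_init B) (q_init B) = q_init A"
    and step: "\<And>x y \<sigma>. x \<in> {1..nstates B} \<Longrightarrow> y \<in> {1..nstates B} \<Longrightarrow> \<sigma> \<in> letters (arity A) \<Longrightarrow>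
       h (delta B x (f \<sigma>)) (delta B y (g \<sigma>)) = delta A (h x y) \<sigma>"
    unfolding simulated_by_def by (metis (no_types))
  have finP: "finite (prog_vars P)" using P finite_prog_vars by (simp add: is_program_def)
  \<comment> \<open>Variables are numbers, so everything from \<open>n\<close> on is fresh.\<close>
  obtain n where n: "\<And>a. a \<in> prog_vars P \<Longrightarrow> a < n"
    using finP finite_nat_set_iff_bounded by metis
  define m where "m = arity B"
  define k where "k = nstates B"
  define bs1 where "bs1 = [n ..< n + m]"
  define bs2 where "bs2 = [n + m ..< n + 2 * m]"
  define qs1 where "qs1 = [n + 2 * m ..< n + 2 * m + k]"
  define qs2 where "qs2 = [n + 2 * m + k ..< n + 2 * m + 2 * k]"
  note fresh_defs = bs1_def bs2_def qs1_def qs2_def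
  have len: "length bs1 = m" "length bs2 = m" "length qs1 = k" "length qs2 = k"
    by (auto simp: fresh_defs)
  \<comment> \<open>The state bits of the first copy fill positions below \<open>k\<close> of
    \<open>v\<close>, those of the second the next \<open>k\<close>; output bit \<open>i\<close>
    stands for state \<open>Suc i\<close>.\<close>
  define H where "H v = map (\<lambda>i. \<exists>x<k. \<exists>y<k. v ! x \<and> v ! (k + y) \<and> h (Suc x) (Suc y) = Suc i)
    [0..<nstates A]" for v :: "bool list"
  define N1 where "N1 = static_block (bs1 @ bs2) (\<lambda>\<sigma>. f \<sigma> @ g \<sigma>) as"
  define N2 where "N2 = {Dynamic qs1 B bs1, Dynamic qs2 B bs2}"
  \<comment> \<open>\<open>H\<close> depends only on the state bits, but listing \<open>as\<close>
    keeps these variables in the program even if \<open>N1\<close> is empty; otherwise input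
    variables could be lost.\<close>
  define N3 where "N3 = static_block ps H (qs1 @ qs2 @ as)"
  define N where "N = N1 \<union> N2 \<union> N3"
  define P' where "P' = P - {r} \<union> N"
  let ?X = "set (bs1 @ bs2)" and ?Y = "set (qs1 @ qs2)"
  have X: "?X \<inter> prog_vars P = {}" and Y: "?Y \<inter> prog_vars P = {}" and XY: "?X \<inter> ?Y = {}"
    using n by (fastforce simp: fresh_defs)+
  have sub: "set ps \<subseteq> prog_vars P" "set as \<subseteq> prog_vars P"
    using rP by (auto simp: prog_vars_def r_def)
  have "ps \<noteq> []" using A(1,2) by (auto simp: wf_operator_def)
  have kpos: "k > 0" using B by (auto simp: wf_operator_def k_def)
  then have qne: "qs1 \<noteq> []" "qs2 \<noteq> []" using len by auto
  have split: "P = (P - {r}) \<union> {r}" using rP by blast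
  have def_rest: "defined_vars P = defined_vars (P - {r}) \<union> set ps"
    by (subst split, subst defined_vars_Un) (simp add: defined_vars_def r_def)
  have var_rest: "prog_vars P = prog_vars (P - {r}) \<union> set ps \<union> set as"
    by (subst split, subst prog_vars_Un) (auto simp: prog_vars_def r_def)
  have disj: "defined_vars (P - {r}) \<inter> set ps = {}"
  proof (rule ccontr)
    assume "defined_vars (P - {r}) \<inter> set ps \<noteq> {}"
    then obtain p r' where "p \<in> set ps" "r' \<in> P - {r}" "p \<in> heads r'" by (auto simp: defined_vars_def)
    then show False using head_unique[OF P rP, of p r'] by (auto simp: r_def)
  qed
  have def_P: "defined_vars P \<subseteq> prog_vars P" by (auto simp: defined_vars_def prog_vars_def)
  have dN: "defined_vars N1 = ?X" "defined_vars N2 = ?Y" "defined_vars N3 = set ps"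
    unfolding N1_def N3_def by (simp_all add: defined_vars_static_block) (auto simp: N2_def defined_vars_def)
  have vN: "prog_vars N1 \<subseteq> ?X \<union> set as" "prog_vars N2 = ?X \<union> ?Y" "prog_vars N3 = set ps \<union> ?Y \<union> set as"
    unfolding N1_def N3_def using prog_vars_static_block_subset \<open>ps \<noteq> []\<close>
    by (blast, auto simp: N2_def prog_vars_def[of "{_, _}"] prog_vars_static_block)
  have def_P': "defined_vars P' = defined_vars P \<union> ?X \<union> ?Y"
    unfolding P'_def N_def using dN def_rest by (auto simp: defined_vars_Un)
  have var_P': "prog_vars P' = prog_vars P \<union> ?X \<union> ?Y"
    unfolding P'_def N_def using vN var_rest by (auto simp: prog_vars_Un)
  have input': "input_vars P' = input_vars P"
    unfolding input_vars_def def_P' var_P' using X Y by blast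
  have prog': "is_program P'"
    unfolding is_program_def
  proof (intro conjI)
    show "finite P'" using P
      by (simp add: is_program_def P'_def N_def N1_def N2_def N3_def static_block_def)
    show "\<forall>r\<in>P'. wf_rule r"
      using P B len by (auto simp: is_program_def P'_def N_def N1_def N2_def N3_def static_block_def
          fresh_defs m_def k_def)
    show "acyclic (dependency P')"
    proof (rule acyclic_dependency_refine[OF P rP X Y XY])
      have "dependency (P - {r}) \<subseteq> dependency P" by (auto simp: dependency_def)
      moreover have "dependency N1 \<subseteq> body_vars r \<times> ?X"
        unfolding N1_def r_def body_vars.simps by (rule dependency_static_block)
      moreover have "dependency N2 \<subseteq> ?X \<times> ?Y" by (auto simp: dependency_def N2_def)
      moreover have "dependency N3 \<subseteq> ?Y \<times> heads r \<union> dependency P"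
      proof -
        \<comment> \<open>The edges created by reading \<open>as\<close> in \<open>N3\<close> were
          already edges of the removed rule.\<close>
        have "set as \<times> set ps \<subseteq> dependency P" using rP by (auto simp: dependency_def r_def)
        moreover have "dependency N3 \<subseteq> set (qs1 @ qs2 @ as) \<times> set ps"
          unfolding N3_def by (rule dependency_static_block)
        ultimately show ?thesis by (auto simp: r_def)
      qed
      ultimately show "dependency P' \<subseteq>
          dependency P \<union> body_vars r \<times> ?X \<union> ?X \<times> ?Y \<union> ?Y \<times> heads r"
        unfolding P'_def N_def dependency_Un by blast
    qed
    have "definitorial N1" "definitorial N3"
      unfolding N1_def N3_def using A(3) by (auto intro!: definitorial_static_block simp: fresh_defs)
    moreover have "definitorial N2"
      using qne by (auto simp: definitorial_def N2_def fresh_defs)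
    moreover have "definitorial (P - {r})" using P by (auto simp: is_program_def definitorial_def)
    ultimately show "definitorial P'"
      unfolding P'_def N_def using X Y XY sub disj def_rest def_P
      by (intro definitorial_Un) (simp_all only: defined_vars_Un dN, blast+)
  qed
  \<comment> \<open>The central claim: through the three layers, the variables \<open>ps\<close>
    follow the run of \<open>A\<close>.\<close>
  have sat: "satisfies (holds P' I) r" for I
  proof -
    define v where "v = holds P' I"
    have v: "satisfies v r'" if "r' \<in> P'" for r'
      using holds_satisfies[OF prog' that] by (simp add: v_def)
    define x where "x = (\<lambda>t. map (v t) as)"
    have x: "x t \<in> letters (arity A)" for t using A(4) by (simp add: x_def letters_def)
    have lfg: "length (f (x t)) = m" "length (g (x t)) = m" for t
      using fg[OF x[of t]] by (auto simp: letters_def m_def)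
    have block: "v t ((bs1 @ bs2) ! i) = (f (x t) @ g (x t)) ! i" if "i < m + m" for t i
      unfolding x_def using that len
      by (intro static_block_satisfies[of _ "\<lambda>\<sigma>. f \<sigma> @ g \<sigma>"] v) (auto simp: P'_def N_def N1_def)
    have bs1: "map (v t) bs1 = f (x t)" for t
    proof (rule nth_equalityI)
      fix i assume "i < length (map (v t) bs1)"
      then show "map (v t) bs1 ! i = f (x t) ! i"
        using block[of i t] len lfg by (simp add: nth_append)
    qed (simp add: len lfg)
    have bs2: "map (v t) bs2 = g (x t)" for t
    proof (rule nth_equalityI)
      fix i assume "i < length (map (v t) bs2)"
      then show "map (v t) bs2 ! i = g (x t) ! i"
        using block[of "m + i" t] len lfg by (simp add: nth_append)
    qed (simp add: len lfg)
    have run1: "v t (qs1 ! i) = (op_run B (f \<circ> x) t = Suc i)" if "i < k" for t i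
      using v[of "Dynamic qs1 B bs1"] that len by (simp add: P'_def N_def N2_def bs1 comp_def)
    have run2: "v t (qs2 ! i) = (op_run B (g \<circ> x) t = Suc i)" if "i < k" for t i
      using v[of "Dynamic qs2 B bs2"] that len by (simp add: P'_def N_def N2_def bs2 comp_def)
    have "v t (ps ! i) = (op_run A x t = Suc i)" if i: "i < length ps" for t i
    proof -
      let ?v = "map (v t) (qs1 @ qs2 @ as)"
      have "v t (ps ! i) = H ?v ! i"
        using i by (intro static_block_satisfies v) (auto simp: P'_def N_def N3_def)
      also have "\<dots> \<longleftrightarrow> (\<exists>x<k. \<exists>y<k. ?v ! x \<and> ?v ! (k + y) \<and> h (Suc x) (Suc y) = Suc i)"
        using i A(2) by (simp add: H_def)
      also have "\<dots> \<longleftrightarrow> (\<exists>p<k. \<exists>q<k. op_run B (f \<circ> x) t = Suc p \<and> op_run B (g \<circ> x) t = Suc q \<and>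
          h (Suc p) (Suc q) = Suc i)"
      proof -
        have "?v ! p = (op_run B (f \<circ> x) t = Suc p)" "?v ! (k + p) = (op_run B (g \<circ> x) t = Suc p)"
          if "p < k" for p
          using that run1 run2 len by (auto simp: nth_append)
        then show ?thesis by auto
      qed
      also have "\<dots> \<longleftrightarrow> h (op_run B (f \<circ> x) t) (op_run B (g \<circ> x) t) = Suc i"
      proof -
        have "op_run B (f \<circ> x) t \<in> {1..k}" "op_run B (g \<circ> x) t \<in> {1..k}"
          unfolding k_def using op_run_in_states[OF B] fg x by auto
        \<comment> \<open>Both runs stay within \<open>1..k\<close>, so the bounded existentials in
          \<open>H\<close> miss no state.\<close>
        then obtain p q where "p < k" "q < k" "op_run B (f \<circ> x) t = Suc p" "op_run B (g \<circ> x) t = Suc q"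
          by (metis Suc_le_eq atLeastAtMost_iff One_nat_def Suc_le_D)
        then show ?thesis by auto
      qed
      also have "\<dots> \<longleftrightarrow> op_run A x t = Suc i"
        using simulation_run[of B x A f g h t, OF B x fg init step] by simp
      finally show ?thesis .
    qed
    then show ?thesis by (simp add: r_def v_def x_def)
  qed
  \<comment> \<open>Uniqueness is applied to the equations of \<open>P\<close>: the kept rules hold
    in \<open>P'\<close> as rules, the removed one by \<open>sat\<close>, and inputs are read from
    the same \<open>I\<close>.\<close>
  have "holds P' I t p = holds P I t p" if "p \<in> prog_vars P" for I t p
  proof (rule satisfies_unique[OF P _ _ _ that])
    show "satisfies (holds P' I) r'" if "r' \<in> P" for r'
      using sat holds_satisfies[OF prog'] that by (cases "r' = r") (auto simp: P'_def)
    show "satisfies (holds P I) r'" if "r' \<in> P" for r' using holds_satisfies[OF P that] .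
    show "holds P' I t p = holds P I t p" if "p \<in> input_vars P" for t p
    proof -
      have "p \<notin> defined_vars P" "p \<notin> defined_vars P'"
        using that input' by (auto simp: input_vars_def)
      then show ?thesis by (simp add: holds_input P prog')
    qed
  qed
  moreover have "uses_operators_from {B} r'" if "r' \<in> N" for r'
    using that by (auto simp: N_def N1_def N2_def N3_def static_block_def)
  moreover have "prog_vars P \<subseteq> prog_vars P'" using var_P' by blast
  ultimately show ?thesis
    using prog' input' unfolding P'_def r_def by (intro exI[of _ N]) simp
qed

section \<open>Translation of whole programs and comparison of logics\<close>

text \<open>Induction on the number of rules with a foreign operator: each replacement removes one
  and adds none. The alternative \<open>A \<in> \<A>\<close> lets the assumption survive the
  replacement, as the added rules use operators from \<open>\<A>\<close>.\<close>

lemma translate_program: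
  assumes "is_program P"
    and "\<And>ps A as. Dynamic ps A as \<in> P \<Longrightarrow> A \<in> \<A> \<or> (\<exists>B\<in>\<A>. wf_operator B \<and> simulated_by A B)"
  shows "\<exists>P'\<in>logic \<A>. input_vars P' = input_vars P \<and> prog_vars P \<subseteq> prog_vars P' \<and>
    (\<forall>I t. \<forall>p\<in>prog_vars P. holds P' I t p = holds P I t p)"
  using assms
proof (induction "card {r\<in>P. \<not> uses_operators_from \<A> r}" arbitrary: P rule: less_induct)
  case less
  note P = less.prems(1)
  show ?case
  proof (cases "\<forall>r\<in>P. uses_operators_from \<A> r")
    case True
    then show ?thesis using P by (auto simp: logic_def)
  next
    case False
    then obtain r where r: "r \<in> P" "\<not> uses_operators_from \<A> r" by blast
    then obtain ps A as where rd: "r = Dynamic ps A as" "A \<notin> \<A>" by (cases r) auto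
    then obtain B where B: "B \<in> \<A>" "wf_operator B" "simulated_by A B" using less.prems(2) r by blast
    obtain N where N: "is_program (P - {r} \<union> N)" "\<forall>r\<in>N. uses_operators_from {B} r"
      "input_vars (P - {r} \<union> N) = input_vars P" "prog_vars P \<subseteq> prog_vars (P - {r} \<union> N)"
      "\<forall>I t. \<forall>p\<in>prog_vars P. holds (P - {r} \<union> N) I t p = holds P I t p"
      using replace_rule[OF P r(1)[unfolded rd(1)] B(2,3)] unfolding rd(1) by (elim exE conjE)
    have use: "uses_operators_from \<A> r'" if "r' \<in> N" for r'
      using bspec[OF N(2) that] B(1) by (cases r') auto
    let ?P = "P - {r} \<union> N"
    have "finite P" using P by (simp add: is_program_def)
    then have "card {r\<in>?P. \<not> uses_operators_from \<A> r} < card {r\<in>P. \<not> uses_operators_from \<A> r}"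
      using r use by (intro psubset_card_mono) auto
    moreover have "A \<in> \<A> \<or> (\<exists>B\<in>\<A>. wf_operator B \<and> simulated_by A B)" if "Dynamic ps A as \<in> ?P" for ps A as
      using that use[of "Dynamic ps A as"] less.prems(2)[of ps A as] by auto
    ultimately obtain P' where "P' \<in> logic \<A>" "input_vars P' = input_vars ?P"
      "prog_vars ?P \<subseteq> prog_vars P'" "\<forall>I t. \<forall>p\<in>prog_vars ?P. holds P' I t p = holds ?P I t p"
      using less.hyps[of ?P] N(1) by blast
    then show ?thesis using N(3,4,5) by (intro bexI[of _ P']) auto
  qed
qed

text \<open>The translated program has the same input variables and agrees on all old variables, so
  the same ordering \<open>vs\<close> and the same designated variable \<open>a\<close> recognise
  the same language.\<close>

lemma logic_le_similar:
  assumes prime: "\<forall>A\<in>\<A>\<^sub>1. prime_operator A" "\<forall>A\<in>\<A>\<^sub>2. prime_operator A"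
    and sim: "\<forall>A\<in>\<A>\<^sub>1. \<exists>B\<in>\<A>\<^sub>2. similar A B"
  shows "logic \<A>\<^sub>1 \<sqsubseteq>\<^sub>L logic \<A>\<^sub>2"
  unfolding logic_le_def
proof
  fix L assume "L \<in> expressivity (logic \<A>\<^sub>1)"
  then obtain P vs a where P: "L = language_of P vs a" "P \<in> logic \<A>\<^sub>1" "distinct vs"
    "set vs = input_vars P" "a \<in> prog_vars P" by (auto simp: expressivity_def)
  have "\<exists>B\<in>\<A>\<^sub>2. wf_operator B \<and> simulated_by A B" if "Dynamic ps A as \<in> P" for ps A as
  proof -
    have "A \<in> \<A>\<^sub>1" using P(2) that by (auto simp: logic_def)
    with sim obtain B where B: "B \<in> \<A>\<^sub>2" "similar A B" by blast
    then have "wf_operator A" "wf_operator B"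
      using prime \<open>A \<in> \<A>\<^sub>1\<close> by (auto simp: prime_operator_def)
    then show ?thesis using B similar_simulated_by by blast
  qed
  then obtain P' where P': "P' \<in> logic \<A>\<^sub>2" "input_vars P' = input_vars P"
    "prog_vars P \<subseteq> prog_vars P'" "\<forall>I t. \<forall>p\<in>prog_vars P. holds P' I t p = holds P I t p"
    using translate_program[of P \<A>\<^sub>2] P(2) by (auto simp: logic_def)
  have "language_of P' vs a = L" using P'(4) P(1,5) by (simp add: language_of_def)
  then show "L \<in> expressivity (logic \<A>\<^sub>2)"
    unfolding expressivity_def using P P' by blast
qed

theorem theorem7:
  fixes \<A>\<^sub>1 \<A>\<^sub>2 :: "op_automaton set"
  assumes "\<forall>A\<in>\<A>\<^sub>1. prime_operator A"
    and "\<forall>A\<in>\<A>\<^sub>2. prime_operator A"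
    and "similar_sets \<A>\<^sub>1 \<A>\<^sub>2"
  shows "logic \<A>\<^sub>1 \<equiv>\<^sub>L logic \<A>\<^sub>2"
  unfolding logic_equiv_def
  using logic_le_similar[OF assms(1,2)] logic_le_similar[OF assms(2,1)] assms(3)
  by (simp add: similar_sets_def)

end
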